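(* For any $m\in\mathbb{Z}_{>0}$, $$\Gamma(m)=\{\mu\in\Lambda(m):\exp(\mathcal{A},\mu)=(m,\ \mu_1+\mu_2)\}.$$
   Context: Let $p$ be a prime, $\mathbb{F}=\mathbb{F}_p$, $S=\mathbb{F}[x,y]$, $\mathrm{Der}_S=S\partial_x\oplus S\partial_y$. Let $\mathcal{A}=\{H_1,H_2,H_3\}$ with $H_1=\ker x$, $H_2=\ker y$, $H_3=\ker(x+y)$, $\alpha_1=x,\alpha_2=y,\alpha_3=x+y$. For $\mu=(\mu_1,\mu_2,\mu_3)\in\mathbb{Z}_{\ge0}^3$, $D(\mathcal{A},\mu)=\{\theta\in\mathrm{Der}_S:\theta(\alpha_i)\in\alpha_i^{\mu_i}S,\ i=1,2,3\}$; it is free of rank 2 with a basis of homogeneous derivations, and $\exp(\mathcal{A},\mu)$ denotes the pair of degrees of such a basis (unique up to order). Let $\Lambda(m)=\{\mu\in\mathbb{Z}_{\ge0}^3:\mu_3=m\}$. For $\mu\in\Lambda(m)$ let $\psi_\mu=\sum_{j=\mu_1}^{m}\binom{m}{j}x^jy^{m-j}\partial_x+\sum_{j=0}^{\mu_1-1}\binom{m}{j}x^jy^{m-j}\partial_y$ (binomial coefficients read in $\mathbb{F}_p$; empty sums are zero) and $\psi'_\mu=x^{\mu_1}y^{\mu_2}(\partial_y-\partial_x)$, and let $\Gamma(m)=\{\mu\in\Lambda(m):\{\psi_\mu,\psi'_\mu\}\text{ is a basis for }D(\mathcal{A},\mu)\}$. *)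

theory Defs
  imports "Berlekamp_Zassenhaus.Finite_Field" "HOL-Library.Product_Plus" "HOL-Library.Multiset"
    "HOL-Computational_Algebra.Polynomial"
begin

text \<open>
  The field with p elements is \<^typ>\<open>'p mod_ring\<close> with p = \<^term>\<open>CARD('p)\<close>, which is prime for
  \<^typ>\<open>'p::prime_card\<close>. The ring S = F[x,y] is represented as F[x][y]: the coefficient of
  x^i y^j in f is \<^term>\<open>coeff (coeff f j) i\<close>.
\<close>

type_synonym 'p S = "'p mod_ring poly poly"

definition var_x :: "'p::prime_card S" where "var_x = [:[:0, 1:]:]"

definition var_y :: "'p::prime_card S" where "var_y = [:0, 1:]"

definition homogeneous :: "nat \<Rightarrow> 'p::prime_card S \<Rightarrow> bool" where
  "homogeneous d f \<longleftrightarrow> (\<forall>i j. coeff (coeff f j) i \<noteq> 0 \<longrightarrow> i + j = d)"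

text \<open>The pair (f, g) stands for the derivation f d/dx + g d/dy of S.\<close>

type_synonym 'p der = "'p S \<times> 'p S"

definition der_apply :: "'p::prime_card der \<Rightarrow> 'p S \<Rightarrow> 'p S" where
  "der_apply \<theta> h = fst \<theta> * map_poly pderiv h + snd \<theta> * pderiv h"

definition der_scale :: "'p::prime_card S \<Rightarrow> 'p der \<Rightarrow> 'p der" where
  "der_scale h \<theta> = (h * fst \<theta>, h * snd \<theta>)"

interpretation der: Modules.module der_scale
  by unfold_locales (auto simp: der_scale_def algebra_simps)

definition is_basis :: "'p::prime_card der set \<Rightarrow> 'p der set \<Rightarrow> bool" where
  "is_basis B M \<longleftrightarrow> der.independent B \<and> der.span B = M"

definition homogeneous_der :: "nat \<Rightarrow> 'p::prime_card der \<Rightarrow> bool" where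
  "homogeneous_der d \<theta> \<longleftrightarrow> homogeneous d (fst \<theta>) \<and> homogeneous d (snd \<theta>)"

text \<open>The module D(A,\<mu>) for the lines x = 0, y = 0, x + y = 0.\<close>

definition multi_der :: "nat \<times> nat \<times> nat \<Rightarrow> 'p::prime_card der set" where
  "multi_der = (\<lambda>(\<mu>1, \<mu>2, \<mu>3). {\<theta>. var_x ^ \<mu>1 dvd der_apply \<theta> var_x \<and>
                                  var_y ^ \<mu>2 dvd der_apply \<theta> var_y \<and>
                                  (var_x + var_y) ^ \<mu>3 dvd der_apply \<theta> (var_x + var_y)})"

text \<open>
  The exponents form an unordered pair, hence a multiset of size two. The type argument selects
  the prime p. The description is proper because \<^term>\<open>multi_der \<mu>\<close> always has a homogeneous
  basis of two elements, and their degrees do not depend on the choice of that basis.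
\<close>

definition exponents :: "'p::prime_card itself \<Rightarrow> nat \<times> nat \<times> nat \<Rightarrow> nat multiset" where
  "exponents _ \<mu> = (THE E. \<exists>(\<theta>1 :: 'p der) \<theta>2 d1 d2.
      \<theta>1 \<noteq> \<theta>2 \<and> is_basis {\<theta>1, \<theta>2} (multi_der \<mu>) \<and>
      homogeneous_der d1 \<theta>1 \<and> homogeneous_der d2 \<theta>2 \<and> E = {#d1, d2#})"

definition Lambda_set :: "nat \<Rightarrow> (nat \<times> nat \<times> nat) set" where
  "Lambda_set m = {(\<mu>1, \<mu>2, \<mu>3). \<mu>3 = m}"

text \<open>
  The exponent m - j is truncated only for j > m, where the binomial coefficient vanishes.
  The third component of \<mu> is m for \<mu> in \<^term>\<open>Lambda_set m\<close>.
\<close>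

definition psi :: "nat \<times> nat \<times> nat \<Rightarrow> 'p::prime_card der" where
  "psi = (\<lambda>(\<mu>1, \<mu>2, m).
     (\<Sum>j=\<mu>1..m. of_nat (m choose j) * var_x ^ j * var_y ^ (m - j),
      \<Sum>j<\<mu>1. of_nat (m choose j) * var_x ^ j * var_y ^ (m - j)))"

definition psi' :: "nat \<times> nat \<times> nat \<Rightarrow> 'p::prime_card der" where
  "psi' = (\<lambda>(\<mu>1, \<mu>2, m). der_scale (var_x ^ \<mu>1 * var_y ^ \<mu>2) (- 1, 1))"

definition Gamma_set :: "'p::prime_card itself \<Rightarrow> nat \<Rightarrow> (nat \<times> nat \<times> nat) set" where
  "Gamma_set _ m = {\<mu> \<in> Lambda_set m. is_basis {psi \<mu> :: 'p der, psi' \<mu>} (multi_der \<mu>)}"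

end

theory Submission imports Defs begin

text \<open>
  The derivation \<open>\<psi>\<close> sends \<open>x + y\<close> to \<open>(x + y)^m\<close> and \<open>\<psi>'\<close> generates the elements of
  \<open>D(A,\<mu>)\<close> that annihilate \<open>x + y\<close>, so \<open>{\<psi>, \<psi>'}\<close> is a basis as soon as \<open>\<psi>\<close> lies in \<open>D(A,\<mu>)\<close>.
  This means that \<open>\<mu>2 \<le> m - j\<close> whenever \<open>j < \<mu>1\<close> and \<open>binom(m,j)\<close> does not vanish mod \<open>p\<close>, which is
  automatic if \<open>\<mu>1 + \<mu>2 \<le> m\<close>. If \<open>\<mu>1 + \<mu>2 > m\<close>, a nonzero homogeneous element of \<open>D(A,\<mu>)\<close> of degree
  \<open>m\<close> cannot annihilate \<open>x + y\<close>, hence up to a scalar it sends \<open>x + y\<close> to \<open>(x + y)^m\<close>; comparing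
  coefficients gives the condition above.

  A homogeneous basis of \<open>D(A,\<mu>)\<close> is obtained from an explicit one for \<open>\<mu>2 = 0\<close> by raising \<open>\<mu>2\<close> one
  step at a time. Modulo \<open>y\<close> the quotients \<open>\<theta>(y) / y^\<mu>2\<close> of the two basis elements are scalar multiples
  of powers of \<open>x\<close>, so one of them can be cleared with the other, and the remaining element is
  multiplied by \<open>y\<close>.
\<close>

abbreviation cf :: "'p::prime_card S \<Rightarrow> nat \<Rightarrow> nat \<Rightarrow> 'p mod_ring" where
  "cf f i j \<equiv> coeff (coeff f j) i"

subsection \<open>Coefficients and homogeneity\<close>

lemma cf_eqI: "(\<And>i j. cf f i j = cf g i j) \<Longrightarrow> f = g"
  by (auto simp: poly_eq_iff)

lemma cf_mult:
  "cf (f * g) i j = (\<Sum>k\<le>j. \<Sum>l\<le>i. cf f l k * cf g (i - l) (j - k))"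
  by (simp add: coeff_mult coeff_sum)

lemma cf_mult_nonzeroE:
  assumes "cf (f * g) i j \<noteq> 0"
  obtains k l where "k \<le> j" "l \<le> i" "cf f l k \<noteq> 0" "cf g (i - l) (j - k) \<noteq> 0"
proof -
  obtain k where "k \<le> j" "(\<Sum>l\<le>i. cf f l k * cf g (i - l) (j - k)) \<noteq> 0"
    using assms unfolding cf_mult by (metis (no_types, lifting) atMost_iff sum.neutral)
  moreover from this obtain l where "l \<le> i" "cf f l k * cf g (i - l) (j - k) \<noteq> 0"
    by (metis (no_types, lifting) atMost_iff sum.neutral)
  ultimately show thesis using that by auto
qed

lemma var_x_power: "(var_x :: 'p::prime_card S) ^ a = [:monom 1 a:]"
  by (induction a) (simp_all add: var_x_def monom_Suc one_pCons monom_0)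

lemma var_y_power: "(var_y :: 'p::prime_card S) ^ b = monom 1 b"
  by (induction b) (simp_all add: var_y_def monom_Suc)

lemma cf_monomial:
  "cf (of_nat n * (var_x :: 'p::prime_card S) ^ a * var_y ^ b) i j = (if i = a \<and> j = b then of_nat n else 0)"
  by (auto simp: var_x_power var_y_power of_nat_poly smult_monom)

lemma var_x_power_dvd_iff: "var_x ^ a dvd f \<longleftrightarrow> (\<forall>i<a. \<forall>j. cf f i j = 0)"
  by (auto simp: var_x_power const_poly_dvd_iff monom_1_dvd_iff')

lemma var_y_power_dvd_iff: "var_y ^ b dvd f \<longleftrightarrow> (\<forall>j<b. coeff f j = 0)"
  by (simp add: var_y_power monom_1_dvd_iff')

lemma var_x_neq_0: "(var_x :: 'p::prime_card S) \<noteq> 0"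
  and var_y_neq_0: "(var_y :: 'p::prime_card S) \<noteq> 0"
  and var_xy_neq_0: "(var_x + var_y :: 'p::prime_card S) \<noteq> 0"
  by (auto simp: var_x_def var_y_def)

text \<open>Coprimality of the two powers, read off coefficients: dividing by
  \<open>var_y ^ b\<close> only shifts the \<open>y\<close>-index, so the vanishing for
  \<open>i < a\<close> survives.\<close>

lemma var_xy_powers_dvd:
  assumes "var_x ^ a dvd f" "var_y ^ b dvd f"
  shows "var_x ^ a * var_y ^ b dvd f"
proof -
  obtain e where e: "f = monom 1 b * e"
    using assms(2) by (auto simp: var_y_power)
  have "cf e i j = 0" if "i < a" for i j
  proof -
    have "cf f i (j + b) = 0" using assms(1) that by (simp add: var_x_power_dvd_iff)
    then show ?thesis by (simp add: e coeff_monom_mult)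
  qed
  then have "var_x ^ a dvd e" by (simp add: var_x_power_dvd_iff)
  then show ?thesis by (simp add: e mult.commute mult_dvd_mono flip: var_y_power)
qed

text \<open>Membership in the \<open>d\<close>-th power of the ideal \<open>(x, y)\<close>.
  Coefficients in a basis expansion need not be homogeneous, and this lower bound still lets degrees
  be compared.\<close>

definition order_ge :: "nat \<Rightarrow> 'p::prime_card S \<Rightarrow> bool" where
  "order_ge d f \<longleftrightarrow> (\<forall>i j. cf f i j \<noteq> 0 \<longrightarrow> d \<le> i + j)"

lemma order_ge_0: "order_ge 0 f"
  by (simp add: order_ge_def)

lemma homogeneous_order_ge: "homogeneous d f \<Longrightarrow> order_ge d f"
  by (auto simp: homogeneous_def order_ge_def)

lemma order_ge_mono: "order_ge d f \<Longrightarrow> e \<le> d \<Longrightarrow> order_ge e f"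
  unfolding order_ge_def by (meson le_trans)

lemma order_ge_add: "order_ge d f \<Longrightarrow> order_ge d g \<Longrightarrow> order_ge d (f + g)"
  unfolding order_ge_def coeff_add by (metis add.right_neutral)

lemma order_ge_mult: 
  assumes "order_ge d f" "order_ge e g" 
  shows "order_ge (d + e) (f * g)"
  unfolding order_ge_def
proof (intro allI impI)
  fix i j assume "cf (f * g) i j \<noteq> 0"
  then obtain k l where "k \<le> j" "l \<le> i" "cf f l k \<noteq> 0" "cf g (i - l) (j - k) \<noteq> 0"
    by (rule cf_mult_nonzeroE)
  moreover from this have "d \<le> l + k" "e \<le> (i - l) + (j - k)"
    using assms unfolding order_ge_def by blast+
  ultimately show "d + e \<le> i + j" by linarith
qed

lemma homogeneous_order_ge_le:
  "homogeneous d f \<Longrightarrow> order_ge e f \<Longrightarrow> f \<noteq> 0 \<Longrightarrow> e \<le> d"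
  unfolding homogeneous_def order_ge_def by (metis cf_eqI coeff_0)

lemma homogeneous_0: "homogeneous d 0"
  by (simp add: homogeneous_def)

lemma homogeneous_add: "homogeneous d f \<Longrightarrow> homogeneous d g \<Longrightarrow> homogeneous d (f + g)"
  unfolding homogeneous_def coeff_add by (metis add.right_neutral)

lemma homogeneous_minus: "homogeneous d f \<Longrightarrow> homogeneous d (- f)"
  by (simp add: homogeneous_def)

lemma homogeneous_sum: "(\<And>j. j \<in> A \<Longrightarrow> homogeneous d (f j)) \<Longrightarrow> homogeneous d (sum f A)"
  by (induction A rule: infinite_finite_induct) (auto intro: homogeneous_0 homogeneous_add)

lemma homogeneous_mult: 
  assumes "homogeneous d f" "homogeneous e g" 
  shows "homogeneous (d + e) (f * g)"
  unfolding homogeneous_def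
proof (intro allI impI)
  fix i j assume "cf (f * g) i j \<noteq> 0"
  then obtain k l where "k \<le> j" "l \<le> i" "cf f l k \<noteq> 0" "cf g (i - l) (j - k) \<noteq> 0"
    by (rule cf_mult_nonzeroE)
  moreover from this have "l + k = d" "(i - l) + (j - k) = e"
    using assms by (auto simp: homogeneous_def)
  ultimately show "i + j = d + e" by linarith
qed

lemma homogeneous_monomial: "homogeneous (a + b) (of_nat n * var_x ^ a * var_y ^ b)"
  by (simp add: homogeneous_def cf_monomial)

lemma homogeneous_const: "homogeneous 0 [:[:c:]:]"
  by (auto simp: homogeneous_def coeff_pCons split: nat.splits)

lemma homogeneous_var_x_power: "homogeneous a (var_x ^ a)"
  using homogeneous_monomial[of a 0 1] by simp

lemma homogeneous_var_y: "homogeneous 1 var_y"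
  using homogeneous_monomial[of 0 1 1] by simp

section \<open>Binomial expansions in degree \<open>m\<close>\<close>

lemma homogeneous_binomial_term:
  "homogeneous m (of_nat (m choose j) * var_x ^ j * var_y ^ (m - j))"
  using homogeneous_monomial[of j "m - j" "m choose j"]
  \<comment> \<open>For \<open>j > m\<close> the exponent \<open>m - j\<close> is truncated, but the
    term is 0 and hence homogeneous of every degree.\<close>
  by (cases "j \<le> m") (auto simp: homogeneous_0 binomial_eq_0)

lemma homogeneous_var_xy_power: "homogeneous m ((var_x + var_y) ^ m)"
  by (auto simp: binomial_ring intro: homogeneous_sum homogeneous_binomial_term)

text \<open>An arbitrary finite \<open>A\<close> covers both components of \<open>psi\<close> as
  well as the full expansion of \<open>(var_x + var_y) ^ m\<close>.\<close>

lemma cf_sum_binomial_terms: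
  assumes "finite A"
  shows "cf (\<Sum>j\<in>A. of_nat (m choose j) * (var_x :: 'p::prime_card S) ^ j * var_y ^ (m - j)) i k
    = (if i \<in> A \<and> i + k = m then of_nat (m choose i) else 0)"
proof -
  have "cf (of_nat (m choose j) * (var_x :: 'p S) ^ j * var_y ^ (m - j)) i k
     = (if j = i then if i + k = m then of_nat (m choose i) else 0 else 0)" for j
    by (cases "j \<le> m") (auto simp: cf_monomial binomial_eq_0)
  then show ?thesis
    using assms by (simp add: coeff_sum)
qed

lemma cf_var_xy_power:
  "cf ((var_x + var_y :: 'p::prime_card S) ^ m) i j = (if i + j = m then of_nat (m choose i) else 0)"
  by (auto simp: binomial_ring cf_sum_binomial_terms)

text \<open>Only the constant term of \<open>h\<close> contributes in the lowest degree \<open>m\<close>.\<close>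

lemma cf_mult_var_xy_power:
  assumes "i + j = m"
  shows "cf (h * (var_x + var_y :: 'p::prime_card S) ^ m) i j = cf h 0 0 * of_nat (m choose i)"
proof -
  \<comment> \<open>Without its constant term \<open>h\<close> has order at least 1, so its product
    with the power starts in degree \<open>m + 1\<close>.\<close>
  define h' where "h' = h - [:[:cf h 0 0:]:]"
  have "order_ge 1 h'"
    by (auto simp: order_ge_def h'_def coeff_pCons split: nat.splits)
  then have "order_ge (1 + m) (h' * (var_x + var_y) ^ m)"
    by (rule order_ge_mult[OF _ homogeneous_order_ge[OF homogeneous_var_xy_power]])
  then have "cf (h' * (var_x + var_y) ^ m) i j = 0"
    using assms unfolding order_ge_def by force
  moreover have "h = h' + [:[:cf h 0 0:]:]" by (simp add: h'_def)
  then have "h * (var_x + var_y) ^ m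
      = h' * (var_x + var_y) ^ m + [:[:cf h 0 0:]:] * (var_x + var_y) ^ m"
    by (metis distrib_right)
  ultimately show ?thesis
    using assms by (simp add: cf_var_xy_power)
qed

subsection \<open>Bases of rank two\<close>

text \<open>The determinant of Saito's criterion. It detects independence, and its degree is the sum
  of the degrees of a homogeneous basis.\<close>

definition der_det :: "'p::prime_card der \<Rightarrow> 'p der \<Rightarrow> 'p S" where
  "der_det \<theta> \<eta> = fst \<theta> * snd \<eta> - snd \<theta> * fst \<eta>"

lemma fst_der_scale [simp]: "fst (der_scale h \<theta>) = h * fst \<theta>"
  and snd_der_scale [simp]: "snd (der_scale h \<theta>) = h * snd \<theta>"
  by (simp_all add: der_scale_def)

lemma independent_pair_iff:
  assumes "\<theta> \<noteq> \<eta>"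
  shows "der.independent {\<theta>, \<eta>} \<longleftrightarrow>
    (\<forall>a b. der_scale a \<theta> + der_scale b \<eta> = 0 \<longrightarrow> a = 0 \<and> b = 0)"
proof -
  have "der.dependent {\<theta>, \<eta>} \<longleftrightarrow>
      (\<exists>u. (u \<theta> \<noteq> 0 \<or> u \<eta> \<noteq> 0) \<and> der_scale (u \<theta>) \<theta> + der_scale (u \<eta>) \<eta> = 0)"
    using assms by (simp add: der.dependent_finite)
  also have "\<dots> \<longleftrightarrow> (\<exists>a b. (a \<noteq> 0 \<or> b \<noteq> 0) \<and> der_scale a \<theta> + der_scale b \<eta> = 0)"
  proof
    assume "\<exists>a b. (a \<noteq> 0 \<or> b \<noteq> 0) \<and> der_scale a \<theta> + der_scale b \<eta> = 0"
    then obtain a b where "a \<noteq> 0 \<or> b \<noteq> 0" "der_scale a \<theta> + der_scale b \<eta> = 0" by blast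
    then show "\<exists>u. (u \<theta> \<noteq> 0 \<or> u \<eta> \<noteq> 0) \<and> der_scale (u \<theta>) \<theta> + der_scale (u \<eta>) \<eta> = 0"
      using assms by (intro exI[of _ "\<lambda>v. if v = \<theta> then a else b"]) auto
  qed blast
  finally show ?thesis by blast
qed

text \<open>If the determinant vanishes, its columns give two relations that force all four entries
  to be 0, so the derivations coincide. The converse is Cramer's rule. The conjunct
  \<open>\<theta> \<noteq> \<eta>\<close> excludes that the set collapses to a singleton.\<close>

lemma independent_pair_iff_det:
  "\<theta> \<noteq> \<eta> \<and> der.independent {\<theta>, \<eta>} \<longleftrightarrow> der_det \<theta> \<eta> \<noteq> 0"
proof
  assume *: "\<theta> \<noteq> \<eta> \<and> der.independent {\<theta>, \<eta>}"
  then have indep: "a = 0 \<and> b = 0" if "der_scale a \<theta> + der_scale b \<eta> = 0" for a b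
    using that by (auto simp: independent_pair_iff)
  show "der_det \<theta> \<eta> \<noteq> 0"
  proof
    assume "der_det \<theta> \<eta> = 0"
    then have "der_scale (fst \<eta>) \<theta> + der_scale (- fst \<theta>) \<eta> = 0"
      "der_scale (snd \<eta>) \<theta> + der_scale (- snd \<theta>) \<eta> = 0"
      by (simp_all add: der_det_def prod_eq_iff algebra_simps)
    from indep[OF this(1)] indep[OF this(2)] * show False
      by (auto simp: prod_eq_iff)
  qed
next
  assume det: "der_det \<theta> \<eta> \<noteq> 0"
  then have "\<theta> \<noteq> \<eta>" by (auto simp: der_det_def)
  moreover have "a = 0 \<and> b = 0" if "der_scale a \<theta> + der_scale b \<eta> = 0" for a b
  proof -
    have 1: "a * fst \<theta> + b * fst \<eta> = 0" "a * snd \<theta> + b * snd \<eta> = 0"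
      using that by (simp_all add: prod_eq_iff)
    have "a * der_det \<theta> \<eta> = (a * fst \<theta> + b * fst \<eta>) * snd \<eta> - (a * snd \<theta> + b * snd \<eta>) * fst \<eta>"
      "b * der_det \<theta> \<eta> = (a * snd \<theta> + b * snd \<eta>) * fst \<theta> - (a * fst \<theta> + b * fst \<eta>) * snd \<theta>"
      by (simp_all add: der_det_def algebra_simps)
    then have "a * der_det \<theta> \<eta> = 0" "b * der_det \<theta> \<eta> = 0"
      unfolding 1 by simp_all
    then show ?thesis using det by simp
  qed
  ultimately show "\<theta> \<noteq> \<eta> \<and> der.independent {\<theta>, \<eta>}"
    by (simp add: independent_pair_iff)
qed

lemma span_pair: "der.span {\<theta>, \<eta>} = {\<zeta>. \<exists>a b. \<zeta> = der_scale a \<theta> + der_scale b \<eta>}"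
proof -
  have "(\<zeta> - der_scale a \<theta> = der_scale b \<eta>) \<longleftrightarrow> (\<zeta> = der_scale a \<theta> + der_scale b \<eta>)" for \<zeta> a b
    by (auto simp: algebra_simps)
  then show ?thesis
    by (auto simp: der.span_insert[of \<theta>] der.span_singleton image_iff)
qed

lemma is_basis_pair_iff:
  "\<theta> \<noteq> \<eta> \<and> is_basis {\<theta>, \<eta>} M \<longleftrightarrow>
    der_det \<theta> \<eta> \<noteq> 0 \<and> (\<forall>\<zeta>. \<zeta> \<in> M \<longleftrightarrow> (\<exists>a b. \<zeta> = der_scale a \<theta> + der_scale b \<eta>))"
  unfolding is_basis_def eq_commute[of _ M] span_pair set_eq_iff[of M] mem_Collect_eq
    independent_pair_iff_det[symmetric] by (rule conj_assoc[symmetric])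

definition homogeneous_basis ::
    "'p::prime_card der set \<Rightarrow> nat \<Rightarrow> 'p der \<Rightarrow> nat \<Rightarrow> 'p der \<Rightarrow> bool" where
  "homogeneous_basis M d \<theta> e \<eta> \<longleftrightarrow>
    \<theta> \<noteq> \<eta> \<and> is_basis {\<theta>, \<eta>} M \<and> homogeneous_der d \<theta> \<and> homogeneous_der e \<eta>"

lemma homogeneous_basis_sym: "homogeneous_basis M d \<theta> e \<eta> \<Longrightarrow> homogeneous_basis M e \<eta> d \<theta>"
  by (auto simp: homogeneous_basis_def insert_commute)

lemma homogeneous_basis_iff:
  "homogeneous_basis M d \<theta> e \<eta> \<longleftrightarrow>
    der_det \<theta> \<eta> \<noteq> 0 \<and> (\<forall>\<zeta>. \<zeta> \<in> M \<longleftrightarrow> (\<exists>a b. \<zeta> = der_scale a \<theta> + der_scale b \<eta>)) \<and>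
    homogeneous_der d \<theta> \<and> homogeneous_der e \<eta>"
  unfolding homogeneous_basis_def
  by (subst conj_assoc[symmetric], subst is_basis_pair_iff, rule conj_assoc)

lemma homogeneous_basis_mem: 
  assumes "homogeneous_basis M d \<theta> e \<eta>"
  shows "\<theta> \<in> M" "\<eta> \<in> M"
  using assms by (auto simp: homogeneous_basis_def is_basis_def intro: der.span_base)

lemma homogeneous_der_det:
  "homogeneous_der d \<theta> \<Longrightarrow> homogeneous_der e \<eta> \<Longrightarrow> homogeneous (d + e) (der_det \<theta> \<eta>)"
  unfolding homogeneous_der_def der_det_def diff_conv_add_uminus
  by (intro homogeneous_add homogeneous_minus homogeneous_mult) auto

subsection \<open>Uniqueness of the exponents\<close>

text \<open>\<open>\<theta>1\<close> is a combination of elements of order at least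
  \<open>e1\<close>, and it is nonzero of degree \<open>d1\<close>.\<close>

lemma min_degree_le:
  assumes "homogeneous_basis M d1 \<theta>1 d2 \<theta>2" "homogeneous_basis M e1 \<eta>1 e2 \<eta>2"
    and "e1 \<le> e2"
  shows "e1 \<le> d1"
proof -
  obtain a b where ab: "\<theta>1 = der_scale a \<eta>1 + der_scale b \<eta>2"
    using homogeneous_basis_mem(1)[OF assms(1)] assms(2) unfolding homogeneous_basis_iff by blast
  have "order_ge e1 (fst \<eta>1)" "order_ge e1 (snd \<eta>1)" "order_ge e1 (fst \<eta>2)" "order_ge e1 (snd \<eta>2)"
    using assms(2,3) unfolding homogeneous_basis_def homogeneous_der_def
    by (auto intro: order_ge_mono homogeneous_order_ge)
  then have "order_ge (0 + e1) (fst \<theta>1)" "order_ge (0 + e1) (snd \<theta>1)"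
    unfolding ab fst_add snd_add fst_der_scale snd_der_scale
    by (intro order_ge_add order_ge_mult order_ge_0; simp)+
  moreover have "homogeneous d1 (fst \<theta>1)" "homogeneous d1 (snd \<theta>1)"
    using assms(1) by (auto simp: homogeneous_basis_def homogeneous_der_def)
  moreover have "fst \<theta>1 \<noteq> 0 \<or> snd \<theta>1 \<noteq> 0"
    using assms(1) by (auto simp: homogeneous_basis_iff der_det_def)
  ultimately show ?thesis
    by (auto dest: homogeneous_order_ge_le)
qed

text \<open>Rewriting one basis in terms of the other multiplies the determinant by that of the
  transition matrix, which cannot lower its order.\<close>

lemma degree_sum_le:
  assumes "homogeneous_basis M d1 \<theta>1 d2 \<theta>2" "homogeneous_basis M e1 \<eta>1 e2 \<eta>2"
  shows "e1 + e2 \<le> d1 + d2"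
proof -
  obtain a b c d where
    ab: "\<theta>1 = der_scale a \<eta>1 + der_scale b \<eta>2" and cd: "\<theta>2 = der_scale c \<eta>1 + der_scale d \<eta>2"
    using homogeneous_basis_mem[OF assms(1)] assms(2) unfolding homogeneous_basis_iff by blast
  have "der_det \<theta>1 \<theta>2 = (a * d - b * c) * der_det \<eta>1 \<eta>2"
    by (simp add: ab cd der_det_def algebra_simps)
  moreover have "order_ge (0 + (e1 + e2)) ((a * d - b * c) * der_det \<eta>1 \<eta>2)"
    using assms(2) unfolding homogeneous_basis_def
    by (intro order_ge_mult order_ge_0 homogeneous_order_ge homogeneous_der_det) auto
  moreover have "homogeneous (d1 + d2) (der_det \<theta>1 \<theta>2)" "der_det \<theta>1 \<theta>2 \<noteq> 0"
    using assms(1) by (auto simp: homogeneous_basis_iff intro: homogeneous_der_det)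
  ultimately show ?thesis
    by (auto dest: homogeneous_order_ge_le)
qed

text \<open>The two bounds, used in both directions, fix the smaller degree and the sum of the
  degrees. Swapping the members of a basis reduces everything to ordered pairs.\<close>

lemma homogeneous_basis_degrees_unique:
  assumes "homogeneous_basis M d1 \<theta>1 d2 \<theta>2" "homogeneous_basis M e1 \<eta>1 e2 \<eta>2"
  shows "{#d1, d2#} = {#e1, e2#}"
proof -
  have ordered: "d1 = e1 \<and> d2 = e2"
    if "homogeneous_basis M d1 \<theta>1 d2 \<theta>2" "homogeneous_basis M e1 \<eta>1 e2 \<eta>2" "d1 \<le> d2" "e1 \<le> e2"
    for d1 d2 e1 e2 \<theta>1 \<theta>2 \<eta>1 \<eta>2
    using min_degree_le[OF that(1,2,4)] min_degree_le[OF that(2,1,3)]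
      degree_sum_le[OF that(1,2)] degree_sum_le[OF that(2,1)] by linarith
  note sym = assms[THEN homogeneous_basis_sym]
  show ?thesis
    using ordered[OF assms] ordered[OF assms(1) sym(2)] ordered[OF sym(1) assms(2)] ordered[OF sym]
    by (cases "d1 \<le> d2"; cases "e1 \<le> e2") (auto simp: add_mset_commute)
qed

lemma exponents_eqI:
  assumes "homogeneous_basis (multi_der \<mu> :: 'p::prime_card der set) d \<theta> e \<eta>"
  shows "exponents TYPE('p) \<mu> = {#d, e#}"
  unfolding exponents_def
proof (rule the_equality)
  show "\<exists>(\<theta>1 :: 'p der) \<theta>2 d1 d2. \<theta>1 \<noteq> \<theta>2 \<and> is_basis {\<theta>1, \<theta>2} (multi_der \<mu>) \<and>
      homogeneous_der d1 \<theta>1 \<and> homogeneous_der d2 \<theta>2 \<and> {#d, e#} = {#d1, d2#}"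
    using assms unfolding homogeneous_basis_def by blast
next
  fix E
  assume "\<exists>(\<theta>1 :: 'p der) \<theta>2 d1 d2. \<theta>1 \<noteq> \<theta>2 \<and> is_basis {\<theta>1, \<theta>2} (multi_der \<mu>) \<and>
      homogeneous_der d1 \<theta>1 \<and> homogeneous_der d2 \<theta>2 \<and> E = {#d1, d2#}"
  then obtain \<theta>1 \<theta>2 :: "'p der" and d1 d2
    where "homogeneous_basis (multi_der \<mu>) d1 \<theta>1 d2 \<theta>2" "E = {#d1, d2#}"
    unfolding homogeneous_basis_def by blast
  then show "E = {#d, e#}"
    using homogeneous_basis_degrees_unique assms by metis
qed

subsection \<open>Existence of a homogeneous basis\<close>

lemma map_poly_pderiv_var_x: "map_poly pderiv (var_x :: 'p::prime_card S) = 1"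
  by (simp add: var_x_def pderiv_pCons one_pCons)

lemma map_poly_pderiv_var_y: "map_poly pderiv (var_y :: 'p::prime_card S) = 0"
  by (simp add: var_y_def pderiv_pCons one_pCons)

lemma map_poly_pderiv_var_xy: "map_poly pderiv (var_x + var_y :: 'p::prime_card S) = 1"
  by (simp add: var_y_def var_x_def pderiv_pCons one_pCons)

lemma mem_multi_der_iff:
  fixes \<theta> :: "'p::prime_card der"
  shows "\<theta> \<in> multi_der (a, b, c) \<longleftrightarrow>
    var_x ^ a dvd fst \<theta> \<and> var_y ^ b dvd snd \<theta> \<and> (var_x + var_y) ^ c dvd fst \<theta> + snd \<theta>"
proof -
  have "pderiv (var_x :: 'p S) = 0" "pderiv (var_y :: 'p S) = 1"
    by (simp_all add: var_x_def var_y_def pderiv_pCons one_pCons)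
  then show ?thesis
    by (simp add: multi_der_def der_apply_def map_poly_pderiv_var_x map_poly_pderiv_var_y
        map_poly_pderiv_var_xy pderiv_add)
qed

section \<open>Raising the multiplicity of \<open>y\<close> by one\<close>

lemma mem_multi_der_Suc_iff:
  "\<theta> \<in> multi_der (a, Suc b, c) \<longleftrightarrow> \<theta> \<in> multi_der (a, b, c) \<and> coeff (snd \<theta>) b = 0"
  by (simp only: mem_multi_der_iff var_y_power_dvd_iff All_less_Suc conj_ac)

text \<open>On \<open>multi_der (a, b, c)\<close>, \<open>coeff (snd \<theta>) b\<close> is the
  residue of \<open>snd \<theta> / y^b\<close> modulo \<open>y\<close>. The residue map is linear
  over \<open>S\<close>, which acts on residues through \<open>coeff h 0\<close>, the class of
  \<open>h\<close> modulo \<open>y\<close>.\<close>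

lemma coeff_snd_scale:
  assumes "\<theta> \<in> multi_der (a, b, c)"
  shows "coeff (h * snd \<theta>) b = coeff h 0 * coeff (snd \<theta>) b"
proof -
  obtain g where "snd \<theta> = monom 1 b * g"
    using assms by (auto simp: mem_multi_der_iff var_y_power)
  moreover from this have "h * snd \<theta> = monom 1 b * (h * g)" by simp
  ultimately show ?thesis by (simp only: coeff_monom_mult) (simp add: coeff_mult_0)
qed

text \<open>The new module is the kernel of the residue map. Only \<theta> has a nonzero residue and
  \<open>F[x]\<close> is a domain, so a combination lies in the kernel exactly when \<open>y\<close>
  divides its coefficient at \<theta>.\<close>

lemma homogeneous_basis_step:
  fixes \<theta> \<eta> :: "'p::prime_card der"
  assumes "homogeneous_basis (multi_der (a, b, c)) d \<theta> e \<eta>"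
    and "coeff (snd \<theta>) b \<noteq> 0" "coeff (snd \<eta>) b = 0"
  shows "homogeneous_basis (multi_der (a, Suc b, c)) (1 + d) (der_scale var_y \<theta>) e \<eta>"
  unfolding homogeneous_basis_iff
proof (intro conjI allI iffI)
  note mem = homogeneous_basis_mem[OF assms(1)]
  have der_det: "der_det (der_scale var_y \<theta>) \<eta> = var_y * der_det \<theta> \<eta>"
    by (simp add: der_det_def algebra_simps)
  show "der_det (der_scale var_y \<theta>) \<eta> \<noteq> 0"
    using assms(1) var_y_neq_0 unfolding der_det homogeneous_basis_iff by simp
  show "homogeneous_der (1 + d) (der_scale var_y \<theta>)" "homogeneous_der e \<eta>"
    using assms(1) homogeneous_mult[OF homogeneous_var_y]
    by (auto simp: homogeneous_basis_def homogeneous_der_def)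
  fix \<zeta> :: "'p der"
  have combination: "coeff (snd (der_scale h \<theta> + der_scale k \<eta>)) b = coeff h 0 * coeff (snd \<theta>) b" for h k
    using assms(3) by (simp add: coeff_snd_scale[OF mem(1)] coeff_snd_scale[OF mem(2)])
  {
    assume "\<zeta> \<in> multi_der (a, Suc b, c)"
    then have \<zeta>: "\<zeta> \<in> multi_der (a, b, c)" "coeff (snd \<zeta>) b = 0"
      by (auto simp: mem_multi_der_Suc_iff)
    then obtain h k where hk: "\<zeta> = der_scale h \<theta> + der_scale k \<eta>"
      using assms(1) unfolding homogeneous_basis_iff by blast
    with \<zeta>(2) combination[of h k] assms(2) have "coeff h 0 = 0" by simp
    then have "var_y ^ 1 dvd h" unfolding var_y_power_dvd_iff by simp
    then obtain l where "h = l * var_y" by (auto simp: dvd_def mult.commute)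
    then have "\<zeta> = der_scale l (der_scale var_y \<theta>) + der_scale k \<eta>"
      using hk by simp
    then show "\<exists>l k. \<zeta> = der_scale l (der_scale var_y \<theta>) + der_scale k \<eta>" by blast
  next
    assume "\<exists>l k. \<zeta> = der_scale l (der_scale var_y \<theta>) + der_scale k \<eta>"
    then obtain l k where lk: "\<zeta> = der_scale (l * var_y) \<theta> + der_scale k \<eta>"
      by auto
    then have "\<zeta> \<in> multi_der (a, b, c)"
      using assms(1) unfolding homogeneous_basis_iff by blast
    moreover have "coeff (snd \<zeta>) b = 0"
      unfolding lk combination by (simp add: coeff_mult_0 var_y_def)
    ultimately show "\<zeta> \<in> multi_der (a, Suc b, c)" by (simp add: mem_multi_der_Suc_iff)
  }
qed

text \<open>An elementary row operation: it preserves the determinant and the span, and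
  \<open>k + d = e\<close> keeps the second element homogeneous.\<close>

lemma homogeneous_basis_shear:
  assumes "homogeneous_basis M d \<theta> e \<eta>" "homogeneous k h" "k + d = e"
  shows "homogeneous_basis M d \<theta> e (\<eta> - der_scale h \<theta>)"
  unfolding homogeneous_basis_iff
proof (intro conjI allI)
  have "der_det \<theta> (\<eta> - der_scale h \<theta>) = der_det \<theta> \<eta>"
    by (simp add: der_det_def algebra_simps)
  then show "der_det \<theta> (\<eta> - der_scale h \<theta>) \<noteq> 0"
    using assms(1) by (simp add: homogeneous_basis_iff)
  show "homogeneous_der d \<theta>" using assms(1) by (simp add: homogeneous_basis_def)
  have "homogeneous (k + d) (h * fst \<theta>)" "homogeneous (k + d) (h * snd \<theta>)"
    using assms(1,2) by (auto simp: homogeneous_basis_def homogeneous_der_def intro: homogeneous_mult)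
  then show "homogeneous_der e (\<eta> - der_scale h \<theta>)"
    using assms(1,3) unfolding homogeneous_der_def homogeneous_basis_def
    by (auto simp: diff_conv_add_uminus simp del: add_uminus_conv_diff
        intro!: homogeneous_add homogeneous_minus)
  fix \<zeta>
  have "der_scale f \<theta> + der_scale g \<eta> = der_scale (f + g * h) \<theta> + der_scale g (\<eta> - der_scale h \<theta>)"
    "der_scale f \<theta> + der_scale g (\<eta> - der_scale h \<theta>) = der_scale (f - g * h) \<theta> + der_scale g \<eta>" for f g
    by (simp_all add: prod_eq_iff algebra_simps)
  then show "\<zeta> \<in> M \<longleftrightarrow> (\<exists>f g. \<zeta> = der_scale f \<theta> + der_scale g (\<eta> - der_scale h \<theta>))"
    using assms(1) unfolding homogeneous_basis_iff by metis
qed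

lemma coeff_homogeneous:
  assumes "homogeneous d f"
  shows "coeff f b = monom (cf f (d - b) b) (d - b)"
proof (rule poly_eqI)
  fix i
  show "coeff (coeff f b) i = coeff (monom (cf f (d - b) b) (d - b)) i"
    \<comment> \<open>If \<open>b > d\<close>, then \<open>d - b\<close> is 0 and homogeneity makes
      both sides vanish.\<close>
    using assms by (cases "i + b = d") (auto simp: homogeneous_def)
qed

text \<open>The residues are \<open>s x^(d-b)\<close> and \<open>t x^(e-b)\<close>. Since
  \<open>d \<le> e\<close>, the first divides the second, with quotient
  \<open>(t/s) x^(e-d)\<close>; this is the choice of \<open>h\<close>.\<close>

lemma homogeneous_basis_reduce:
  assumes "homogeneous_basis (multi_der (a, b, c)) d \<theta> e \<eta>" "d \<le> e" "coeff (snd \<theta>) b \<noteq> 0"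
  shows "\<exists>\<eta>'. homogeneous_basis (multi_der (a, b, c)) d \<theta> e \<eta>' \<and> coeff (snd \<eta>') b = 0"
proof -
  define s where "s = cf (snd \<theta>) (d - b) b"
  define t where "t = cf (snd \<eta>) (e - b) b"
  define h where "h = [:[:t / s:]:] * var_x ^ (e - d)"
  have hom: "homogeneous d (snd \<theta>)" "homogeneous e (snd \<eta>)"
    using assms(1) by (auto simp: homogeneous_basis_def homogeneous_der_def)
  have st: "coeff (snd \<theta>) b = monom s (d - b)" "coeff (snd \<eta>) b = monom t (e - b)"
    using hom[THEN coeff_homogeneous] by (simp_all add: s_def t_def)
  then have "s \<noteq> 0" using assms(3) by auto
  \<comment> \<open>This ensures \<open>(e - d) + (d - b) = e - b\<close> despite truncated
    subtraction.\<close>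
  then have "b \<le> d"
    using hom(1) unfolding homogeneous_def s_def by (metis le_add2)
  have "homogeneous (0 + (e - d)) h"
    unfolding h_def by (intro homogeneous_mult homogeneous_const homogeneous_var_x_power)
  then have "homogeneous_basis (multi_der (a, b, c)) d \<theta> e (\<eta> - der_scale h \<theta>)"
    by (rule homogeneous_basis_shear[OF assms(1)]) (use assms(2) in simp)
  moreover have "coeff h 0 * monom s (d - b) = monom t (e - b)"
    using \<open>s \<noteq> 0\<close> \<open>b \<le> d\<close> \<open>d \<le> e\<close>
    by (simp add: h_def var_x_power mult_monom smult_monom)
  then have "coeff (snd (\<eta> - der_scale h \<theta>)) b = 0"
    using homogeneous_basis_mem(1)[OF assms(1)] by (simp add: coeff_snd_scale st)
  ultimately show ?thesis by blast
qed

text \<open>With no condition at \<open>y\<close>, the values at \<open>x\<close> and at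
  \<open>x + y\<close> can be prescribed independently, as multiples of \<open>x^a\<close> and
  \<open>(x + y)^c\<close>. Each basis element has one of these values equal to 0.\<close>

lemma homogeneous_basis_base:
  "homogeneous_basis (multi_der (a, 0, c)) a (var_x ^ a, - (var_x ^ a)) c (0, (var_x + var_y :: 'p::prime_card S) ^ c)"
  unfolding homogeneous_basis_iff
proof (intro conjI allI)
  show "der_det (var_x ^ a, - (var_x ^ a)) (0, (var_x + var_y) ^ c) \<noteq> 0"
    by (simp add: der_det_def var_x_neq_0 var_xy_neq_0)
  show "homogeneous_der a (var_x ^ a, - (var_x ^ a))" "homogeneous_der c (0, (var_x + var_y) ^ c)"
    by (simp_all add: homogeneous_der_def homogeneous_var_x_power homogeneous_minus homogeneous_0
        homogeneous_var_xy_power)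
  fix \<zeta> :: "'p der"
  obtain f g where \<zeta>: "\<zeta> = (f, g)" by fastforce
  have "\<zeta> \<in> multi_der (a, 0, c) \<longleftrightarrow> (\<exists>u v. f = var_x ^ a * u \<and> f + g = (var_x + var_y) ^ c * v)"
    by (auto simp: \<zeta> mem_multi_der_iff dvd_def)
  also have "\<dots> \<longleftrightarrow> (\<exists>u v. \<zeta> = der_scale u (var_x ^ a, - (var_x ^ a)) + der_scale v (0, (var_x + var_y) ^ c))"
    by (intro ex_cong1) (auto simp: \<zeta> der_scale_def algebra_simps)
  finally show "\<zeta> \<in> multi_der (a, 0, c) \<longleftrightarrow>
    (\<exists>u v. \<zeta> = der_scale u (var_x ^ a, - (var_x ^ a)) + der_scale v (0, (var_x + var_y) ^ c))" .
qed

lemma ex_homogeneous_basis: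
  "\<exists>d \<theta> e \<eta>. homogeneous_basis (multi_der (a, b, c) :: 'p::prime_card der set) d \<theta> e \<eta>"
proof (induction b)
  case 0
  show ?case using homogeneous_basis_base by blast
next
  case (Suc b)
  let ?M = "multi_der (a, b, c) :: 'p der set"
  obtain d \<theta> e \<eta> where B: "homogeneous_basis ?M d \<theta> e \<eta>" using Suc.IH by blast
  consider "coeff (snd \<theta>) b = 0" "coeff (snd \<eta>) b = 0"
    | "coeff (snd \<theta>) b \<noteq> 0" "coeff (snd \<eta>) b = 0" | "coeff (snd \<theta>) b = 0" "coeff (snd \<eta>) b \<noteq> 0"
    | "coeff (snd \<theta>) b \<noteq> 0" "coeff (snd \<eta>) b \<noteq> 0" by blast
  then show ?case
  proof cases
    case 1
    note mem = homogeneous_basis_mem[OF B]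
    have "coeff (snd (der_scale f \<theta> + der_scale g \<eta>)) b = 0" for f g
      using 1 by (simp add: coeff_snd_scale[OF mem(1)] coeff_snd_scale[OF mem(2)])
    then have "coeff (snd \<zeta>) b = 0" if "\<zeta> \<in> ?M" for \<zeta>
      using B that unfolding homogeneous_basis_iff by metis
    then have "multi_der (a, Suc b, c) = ?M"
      by (auto simp: mem_multi_der_Suc_iff)
    then show ?thesis using B by metis
  next
    case 2
    then show ?thesis using homogeneous_basis_step[OF B] by blast
  next
    case 3
    then show ?thesis using homogeneous_basis_step[OF homogeneous_basis_sym[OF B]] by blast
  next
    case 4
    \<comment> \<open>The element of smaller degree clears the residue of the other and is then
      itself multiplied by \<open>y\<close>.\<close>
    show ?thesis
    proof (cases "d \<le> e")
      case True
      then show ?thesis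
        using homogeneous_basis_reduce[OF B] homogeneous_basis_step 4 by blast
    next
      case False
      then show ?thesis
        using homogeneous_basis_reduce[OF homogeneous_basis_sym[OF B]] homogeneous_basis_step 4
        by (meson nat_le_linear)
    qed
  qed
qed

subsection \<open>The derivations psi and psi'\<close>

lemma psi_sum: "fst (psi (a, b, m)) + snd (psi (a, b, m)) = (var_x + var_y :: 'p::prime_card S) ^ m"
proof (rule cf_eqI)
  fix i j
  show "cf (fst (psi (a, b, m)) + snd (psi (a, b, m))) i j = cf ((var_x + var_y :: 'p S) ^ m) i j"
    by (auto simp: psi_def cf_sum_binomial_terms cf_var_xy_power)
qed

text \<open>The conditions at \<open>x\<close> and \<open>x + y\<close> hold by construction. At
  \<open>y\<close>, the terms of \<open>snd (psi (a, b, m))\<close> with \<open>y\<close>-exponent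
  below \<open>b\<close> have to vanish.\<close>

lemma psi_mem_iff:
  "(psi (a, b, m) :: 'p::prime_card der) \<in> multi_der (a, b, m) \<longleftrightarrow>
    (\<forall>i j. i < a \<and> j < b \<and> i + j = m \<longrightarrow> of_nat (m choose i) = (0 :: 'p mod_ring))"
proof -
  have "var_x ^ a dvd fst (psi (a, b, m) :: 'p der)"
    by (simp add: var_x_power_dvd_iff psi_def cf_sum_binomial_terms)
  moreover have "var_y ^ b dvd snd (psi (a, b, m) :: 'p der) \<longleftrightarrow>
      (\<forall>i j. i < a \<and> j < b \<and> i + j = m \<longrightarrow> of_nat (m choose i) = (0 :: 'p mod_ring))"
    by (auto simp: var_y_power_dvd_iff poly_eq_iff psi_def cf_sum_binomial_terms)
  ultimately show ?thesis
    by (simp add: mem_multi_der_iff psi_sum)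
qed

lemma homogeneous_psi: "homogeneous_der m (psi (a, b, m))"
  by (auto simp: homogeneous_der_def psi_def intro!: homogeneous_sum homogeneous_binomial_term)

lemma homogeneous_psi': "homogeneous_der (a + b) (psi' (a, b, m))"
  using homogeneous_monomial[of a b 1]
  by (auto simp: homogeneous_der_def psi'_def intro: homogeneous_minus)

lemma homogeneous_basis_psi:
  assumes psi: "(psi (a, b, m) :: 'p::prime_card der) \<in> multi_der (a, b, m)"
  shows "homogeneous_basis (multi_der (a, b, m)) m (psi (a, b, m) :: 'p der) (a + b) (psi' (a, b, m))"
  unfolding homogeneous_basis_iff
proof (intro conjI homogeneous_psi homogeneous_psi' allI iffI)
  let ?\<psi> = "psi (a, b, m) :: 'p der" and ?\<psi>' = "psi' (a, b, m) :: 'p der"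
  let ?Q = "var_x ^ a * var_y ^ b :: 'p S"
  have psi': "fst ?\<psi>' = - ?Q" "snd ?\<psi>' = ?Q" by (simp_all add: psi'_def)
  \<comment> \<open>By \<open>psi_sum\<close> this is the product of the defining forms with their
    multiplicities, as in Saito's criterion.\<close>
  have "der_det ?\<psi> ?\<psi>' = (fst ?\<psi> + snd ?\<psi>) * ?Q"
    by (simp add: der_det_def psi' algebra_simps)
  then show "der_det ?\<psi> ?\<psi>' \<noteq> 0"
    by (simp add: psi_sum var_x_neq_0 var_y_neq_0 var_xy_neq_0)
  fix \<zeta> :: "'p der"
  {
    assume \<zeta>: "\<zeta> \<in> multi_der (a, b, m)"
    then obtain h where h: "fst \<zeta> + snd \<zeta> = h * (var_x + var_y) ^ m"
      unfolding mem_multi_der_iff by (metis dvdE mult.commute)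
    \<comment> \<open>Subtracting \<open>h\<close> times \<open>psi\<close> leaves a derivation
      annihilating \<open>x + y\<close>, that is \<open>(- r, r)\<close>; the conditions at
      \<open>x\<close> and \<open>y\<close> then make \<open>r\<close> a multiple of
      \<open>?Q\<close>.\<close>
    define r where "r = snd \<zeta> - h * snd ?\<psi>"
    have "fst \<zeta> + snd \<zeta> = h * fst ?\<psi> + h * snd ?\<psi>"
      unfolding h by (simp flip: psi_sum[of a b m] add: algebra_simps)
    then have r': "- r = fst \<zeta> - h * fst ?\<psi>" by (simp add: r_def algebra_simps)
    have "var_x ^ a dvd - r"
      unfolding r' using \<zeta> psi by (auto simp: mem_multi_der_iff)
    moreover have "var_y ^ b dvd r"
      unfolding r_def using \<zeta> psi by (auto simp: mem_multi_der_iff)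
    ultimately have "?Q dvd r" by (auto intro: var_xy_powers_dvd)
    then obtain k where k: "r = k * ?Q" by (metis dvdE mult.commute)
    have "\<zeta> = der_scale h ?\<psi> + der_scale k ?\<psi>'"
      using r_def r' k by (simp add: prod_eq_iff psi' algebra_simps)
    then show "\<exists>h k. \<zeta> = der_scale h ?\<psi> + der_scale k ?\<psi>'" by blast
  next
    assume "\<exists>h k. \<zeta> = der_scale h ?\<psi> + der_scale k ?\<psi>'"
    then obtain h k where hk: "\<zeta> = der_scale h ?\<psi> + der_scale k ?\<psi>'" by blast
    have "fst \<zeta> + snd \<zeta> = h * (fst ?\<psi> + snd ?\<psi>)"
      by (simp add: hk psi' algebra_simps)
    then have "(var_x + var_y) ^ m dvd fst \<zeta> + snd \<zeta>"
      by (simp add: psi_sum)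
    then show "\<zeta> \<in> multi_der (a, b, m)"
      using psi by (simp add: mem_multi_der_iff hk psi')
  }
qed

lemma is_basis_psi_iff:
  "is_basis {psi (a, b, m) :: 'p::prime_card der, psi' (a, b, m)} (multi_der (a, b, m)) \<longleftrightarrow>
    psi (a, b, m) \<in> (multi_der (a, b, m) :: 'p der set)"
proof
  assume "is_basis {psi (a, b, m) :: 'p der, psi' (a, b, m)} (multi_der (a, b, m))"
  then show "psi (a, b, m) \<in> (multi_der (a, b, m) :: 'p der set)"
    unfolding is_basis_def by (metis der.span_base insertI1)
next
  assume "psi (a, b, m) \<in> (multi_der (a, b, m) :: 'p der set)"
  from homogeneous_basis_psi[OF this]
  show "is_basis {psi (a, b, m) :: 'p der, psi' (a, b, m)} (multi_der (a, b, m))"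
    by (simp add: homogeneous_basis_def)
qed

lemma psi_mem_if_homogeneous:
  fixes \<theta> :: "'p::prime_card der"
  assumes \<theta>: "\<theta> \<in> multi_der (a, b, m)" "homogeneous_der m \<theta>" "\<theta> \<noteq> 0"
  shows "(psi (a, b, m) :: 'p der) \<in> multi_der (a, b, m)"
proof -
  obtain h where h: "fst \<theta> + snd \<theta> = h * (var_x + var_y) ^ m"
    using \<theta>(1) unfolding mem_multi_der_iff by (metis dvdE mult.commute)
  have sum: "cf (fst \<theta>) i j + cf (snd \<theta>) i j = cf h 0 0 * of_nat (m choose i)" if "i + j = m" for i j
    using cf_mult_var_xy_power[OF that, of h] by (simp flip: h)
  have fst_0: "cf (fst \<theta>) i j = 0" if "i < a" for i j
    using \<theta>(1) that by (simp add: mem_multi_der_iff var_x_power_dvd_iff)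
  have snd_0: "cf (snd \<theta>) i j = 0" if "j < b" for i j
    using \<theta>(1) that by (simp add: mem_multi_der_iff var_y_power_dvd_iff)
  have hom: "cf (fst \<theta>) i j = 0" "cf (snd \<theta>) i j = 0" if "i + j \<noteq> m" for i j
    using \<theta>(2) that by (auto simp: homogeneous_der_def homogeneous_def)
  show ?thesis
    unfolding psi_mem_iff
  proof (intro allI impI)
    fix i j assume ij: "i < a \<and> j < b \<and> i + j = m"
    show "of_nat (m choose i) = (0 :: 'p mod_ring)"
    proof (rule ccontr)
      assume "of_nat (m choose i) \<noteq> (0 :: 'p mod_ring)"
      \<comment> \<open>At \<open>(i, j)\<close> both components of \<theta> vanish, because
        \<open>i < a\<close> and \<open>j < b\<close>, while the binomial coefficient is
        nonzero.\<close>
      then have h0: "cf h 0 0 = 0"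
        using sum[of i j] fst_0[of i j] snd_0[of j i] ij by simp
      \<comment> \<open>By \<open>h0\<close> the two coefficients add up to 0 in degree
        \<open>m\<close>, so it suffices that one of them vanishes.\<close>
      have "cf (fst \<theta>) k l = 0 \<and> cf (snd \<theta>) k l = 0" for k l
      proof (cases "k + l = m")
        case True
        \<comment> \<open>the point \<open>(i, j)\<close> shows \<open>m < a + b\<close>\<close>
        then have "k < a \<or> l < b" using ij by linarith
        then show ?thesis
          using sum[OF True] h0 fst_0[of k l] snd_0[of l k] by auto
      qed (use hom in auto)
      then have "fst \<theta> = 0" "snd \<theta> = 0" by (auto intro!: cf_eqI)
      then show False using \<theta>(3) by (simp add: prod_eq_iff)
    qed
  qed
qed

theorem theorem5p6:
  fixes m :: nat
  assumes "m > 0"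
  shows "Gamma_set TYPE('p::prime_card) m =
    {(\<mu>1, \<mu>2, \<mu>3) \<in> Lambda_set m. exponents TYPE('p) (\<mu>1, \<mu>2, \<mu>3) = {#m, \<mu>1 + \<mu>2#}}"
proof -
  have "psi (a, b, m) \<in> (multi_der (a, b, m) :: 'p der set) \<longleftrightarrow>
      exponents TYPE('p) (a, b, m) = {#m, a + b#}" for a b
  proof
    assume "psi (a, b, m) \<in> (multi_der (a, b, m) :: 'p der set)"
    then show "exponents TYPE('p) (a, b, m) = {#m, a + b#}"
      by (rule exponents_eqI[OF homogeneous_basis_psi])
  next
    assume exp: "exponents TYPE('p) (a, b, m) = {#m, a + b#}"
    obtain d e and \<theta> \<eta> :: "'p der" where B: "homogeneous_basis (multi_der (a, b, m)) d \<theta> e \<eta>"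
      using ex_homogeneous_basis by blast
    then have "{#d, e#} = {#m, a + b#}" using exponents_eqI exp by metis
    \<comment> \<open>Only a nonzero element of degree \<open>m\<close> is needed from the basis; it
      forces \<open>psi\<close> into the module.\<close>
    then have "d = m \<or> e = m" by (metis insert_iff set_mset_add_mset_insert singletonD set_mset_empty)
    moreover have "\<theta> \<noteq> 0" "\<eta> \<noteq> 0"
      using B by (auto simp: homogeneous_basis_iff der_det_def)
    moreover have "homogeneous_der d \<theta>" "homogeneous_der e \<eta>"
      using B by (simp_all add: homogeneous_basis_def)
    ultimately show "psi (a, b, m) \<in> (multi_der (a, b, m) :: 'p der set)"
      using homogeneous_basis_mem[OF B] psi_mem_if_homogeneous by metis
  qed
  then show ?thesis
    unfolding Gamma_set_def Lambda_set_def by (auto simp: is_basis_psi_iff)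
qed

end
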